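(* Let $X$ be a treatment variable with $m$ values $x_1,\dots,x_m$ and $Y$ an effect variable with $n$ values $y_1,\dots,y_n$ in a structural causal model. Let $k\ge 2$, let $1\le i_1,\dots,i_k,q\le n$, and let $1\le j_1,\dots,j_k,p\le m$ with $j_1,\dots,j_k,p$ pairwise distinct. Put $S=\{(i_1,j_1),\dots,(i_k,j_k)\}$, $S_{-t}=S\setminus\{(i_t,j_t)\}$ and $S_t=\{(i_t,j_t)\}$. With the recursively defined quantities $L(\cdot),U(\cdot),L(\cdot\,;p,q),U(\cdot\,;p,q)$ of the context, the probability $P(Y_{x_{j_1}}=y_{i_1},\dots,Y_{x_{j_k}}=y_{i_k},X=x_p,Y=y_q)$ is at least the maximum of the three quantities (1) $0$; (2) $\sum_{t=1}^{k}P(Y_{x_{j_t}}=y_{i_t})+P(X=x_p,Y=y_q)-k$; (3) $\max_{1\le t\le k}\big(L(S_{-t})+L(S_t;p,q)-1\big)$; and at most the minimum of the four quantities (1') $\min_{1\le t\le k}P(Y_{x_{j_t}}=y_{i_t})$; (2') $P(X=x_p,Y=y_q)$; (3') $\min_{1\le t\le k}U(S_{-t})$; (4') $\min_{1\le t\le k}U(S_t;p,q)$.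
   Context: Setting. $Y_{x_j}$ denotes the counterfactual (potential outcome) variable "the value $Y$ would have, had $X$ been $x_j$". The structural causal model induces one probability space $P$ on which $X$, $Y$, and $Y_{x_1},\dots,Y_{x_m}$ (each with values in $\{y_1,\dots,y_n\}$) are jointly defined, and they satisfy consistency: on the event $X=x_j$ one has $Y_{x_j}=Y$. The values $x_1,\dots,x_m$ are distinct, as are $y_1,\dots,y_n$. Recursive bounds. Throughout, $S=\{(i_1,j_1),\dots,(i_k,j_k)\}$ with $k\ge1$, $1\le i_t\le n$, $1\le j_t\le m$ and $j_1,\dots,j_k$ pairwise distinct; $J=\{j_1,\dots,j_k\}$; $S_{-t}=S\setminus\{(i_t,j_t)\}$; $S_t=\{(i_t,j_t)\}$; $1\le p\le m$ with $p\notin J$; $1\le q\le n$. Write $a_t=P(Y_{x_{j_t}}=y_{i_t})$, and write $P(x_p)$ for $P(X=x_p)$ and $P(x_p,y_q)$ for $P(X=x_p,Y=y_q)$. $L(S),U(S)$ are the lower and upper bounds used for $P(Y_{x_{j_1}}=y_{i_1},\dots,Y_{x_{j_k}}=y_{i_k})$; $L(S;p),U(S;p)$ those used for $P(Y_{x_{j_1}}=y_{i_1},\dots,Y_{x_{j_k}}=y_{i_k},X=x_p)$; $L(S;p,q),U(S;p,q)$ those used for $P(Y_{x_{j_1}}=y_{i_1},\dots,Y_{x_{j_k}}=y_{i_k},X=x_p,Y=y_q)$. They are the following numbers, defined by recursion on $k$. Case $k=1$, $S=\{(i,j)\}$, $a=P(Y_{x_j}=y_i)$: $L(S)=U(S)=a$;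 $L(S;p)=\max\{0,\ a-P(x_j,y_i)-1+P(x_j)+P(x_p)\}$; $U(S;p)=\min\{a-P(x_j,y_i),\ P(x_p)\}$; $L(S;p,q)=\max\{0,\ a+P(x_p,y_q)-1+P(x_j)-P(x_j,y_i)\}$; $U(S;p,q)=\min\{a-P(x_j,y_i),\ P(x_p,y_q)\}$. Case $k\ge2$: $L(S;p)=\max\{0,\ \sum_{t}a_t+P(x_p)-k,\ \max_{t}(L(S_{-t})+L(S_t;p)-1)\}$; $U(S;p)=\min\{\min_t a_t,\ P(x_p),\ \min_t U(S_{-t}),\ \min_t U(S_t;p)\}$; $L(S;p,q)=\max\{0,\ \sum_{t}a_t+P(x_p,y_q)-k,\ \max_{t}(L(S_{-t})+L(S_t;p,q)-1)\}$; $U(S;p,q)=\min\{\min_t a_t,\ P(x_p,y_q),\ \min_t U(S_{-t}),\ \min_t U(S_t;p,q)\}$; $L(S)=\max\{0,\ \sum_t a_t-k+1,\ \max_t(L(S_{-t})+a_t-1),\ \sum_{r=1}^kL(S_{-r};j_r,i_r)+\sum_{p\notin J}L(S;p)\}$; $U(S)=\min\{\min_t a_t,\ \min_tU(S_{-t}),\ \sum_{r=1}^kU(S_{-r};j_r,i_r)+\sum_{p\notin J}U(S;p)\}$, where $t$ ranges over $1,\dots,k$ and $p\notin J$ means $p\in\{1,\dots,m\}\setminus J$. *)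

theory Defs
  imports "HOL-Probability.Probability"
begin

text \<open>
  \<open>Yc v\<close> is the counterfactual outcome \<open>Y\<^sub>v\<close>, the value of \<open>Y\<close> had \<open>X\<close> been \<open>v\<close>.  Of the
  structural causal model only the induced joint distribution of \<open>X\<close>, \<open>Y\<close> and the
  counterfactuals, together with consistency, is retained.  Nothing is assumed about \<open>Yc v\<close>
  for \<open>v\<close> outside the listed treatment values.
\<close>

locale counterfactual_model = prob_space M
  for M :: "'w measure" +
  fixes X :: "'w \<Rightarrow> 'x" and Y :: "'w \<Rightarrow> 'y" and Yc :: "'x \<Rightarrow> 'w \<Rightarrow> 'y"
    and x :: "nat \<Rightarrow> 'x" and m :: nat
    and y :: "nat \<Rightarrow> 'y" and n :: nat
  assumes inj_x: "inj_on x {1..m}"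
    and inj_y: "inj_on y {1..n}"
    and measurable_X: "X \<in> M \<rightarrow>\<^sub>M count_space (x ` {1..m})"
    and measurable_Y: "Y \<in> M \<rightarrow>\<^sub>M count_space (y ` {1..n})"
    and measurable_Yc: "\<And>j. j \<in> {1..m} \<Longrightarrow> Yc (x j) \<in> M \<rightarrow>\<^sub>M count_space (y ` {1..n})"
    and consistency:
      "\<And>j \<omega>. j \<in> {1..m} \<Longrightarrow> \<omega> \<in> space M \<Longrightarrow> X \<omega> = x j \<Longrightarrow> Yc (x j) \<omega> = Y \<omega>"
begin

definition PYc :: "nat \<Rightarrow> nat \<Rightarrow> real"
  where "PYc i j = \<P>(\<omega> in M. Yc (x j) \<omega> = y i)"

definition PX :: "nat \<Rightarrow> real"
  where "PX p = \<P>(\<omega> in M. X \<omega> = x p)"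

definition PXY :: "nat \<Rightarrow> nat \<Rightarrow> real"
  where "PXY p q = \<P>(\<omega> in M. X \<omega> = x p \<and> Y \<omega> = y q)"

text \<open>
  A set \<open>S\<close> of pairs \<open>(i, j)\<close> stands for the event that \<open>Yc (x j) = y i\<close> for all \<open>(i, j) \<in> S\<close>.
  The suffix \<open>X\<close> adds the event \<open>X = x p\<close>, the suffix \<open>XY\<close> adds \<open>X = x p\<close> and \<open>Y = y q\<close>.
  The functions are only meaningful for finite nonempty \<open>S\<close> with pairwise distinct second
  components, so the branch \<open>card S \<le> 1\<close> is the case of a singleton; its value on empty or
  infinite \<open>S\<close> is never used by the recursion.
\<close>

function (sequential)
  L :: "(nat \<times> nat) set \<Rightarrow> real" and
  LX :: "(nat \<times> nat) set \<Rightarrow> nat \<Rightarrow> real" and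
  LXY :: "(nat \<times> nat) set \<Rightarrow> nat \<Rightarrow> nat \<Rightarrow> real"
where
  "L S =
    (if card S \<le> 1 then (let (i, j) = the_elem S in PYc i j)
     else Max {0,
       (\<Sum>(i, j)\<in>S. PYc i j) - real (card S) + 1,
       (MAX (i, j)\<in>S. L (S - {(i, j)}) + PYc i j - 1),
       (\<Sum>(i, j)\<in>S. LXY (S - {(i, j)}) j i) + (\<Sum>p\<in>{1..m} - snd ` S. LX S p)})"
| "LX S p =
    (if card S \<le> 1 then
       (let (i, j) = the_elem S in max 0 (PYc i j - PXY j i - 1 + PX j + PX p))
     else Max {0,
       (\<Sum>(i, j)\<in>S. PYc i j) + PX p - real (card S),
       (MAX (i, j)\<in>S. L (S - {(i, j)}) + LX {(i, j)} p - 1)})"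
| "LXY S p q =
    (if card S \<le> 1 then
       (let (i, j) = the_elem S in max 0 (PYc i j + PXY p q - 1 + PX j - PXY j i))
     else Max {0,
       (\<Sum>(i, j)\<in>S. PYc i j) + PXY p q - real (card S),
       (MAX (i, j)\<in>S. L (S - {(i, j)}) + LXY {(i, j)} p q - 1)})"
  by pat_completeness auto
termination
  by (relation "measures
      [case_sum card (case_sum (\<lambda>(S, p). card S) (\<lambda>(S, p, q). card S)),
       case_sum (\<lambda>_. 1) (\<lambda>_. 0)]")
    (auto intro!: card_Diff1_less intro: card_ge_0_finite)

function (sequential)
  U :: "(nat \<times> nat) set \<Rightarrow> real" and
  UX :: "(nat \<times> nat) set \<Rightarrow> nat \<Rightarrow> real" and
  UXY :: "(nat \<times> nat) set \<Rightarrow> nat \<Rightarrow> nat \<Rightarrow> real"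
where
  "U S =
    (if card S \<le> 1 then (let (i, j) = the_elem S in PYc i j)
     else Min {
       (MIN (i, j)\<in>S. PYc i j),
       (MIN (i, j)\<in>S. U (S - {(i, j)})),
       (\<Sum>(i, j)\<in>S. UXY (S - {(i, j)}) j i) + (\<Sum>p\<in>{1..m} - snd ` S. UX S p)})"
| "UX S p =
    (if card S \<le> 1 then (let (i, j) = the_elem S in min (PYc i j - PXY j i) (PX p))
     else Min {
       (MIN (i, j)\<in>S. PYc i j),
       PX p,
       (MIN (i, j)\<in>S. U (S - {(i, j)})),
       (MIN (i, j)\<in>S. UX {(i, j)} p)})"
| "UXY S p q =
    (if card S \<le> 1 then (let (i, j) = the_elem S in min (PYc i j - PXY j i) (PXY p q))
     else Min {
       (MIN (i, j)\<in>S. PYc i j),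
       PXY p q,
       (MIN (i, j)\<in>S. U (S - {(i, j)})),
       (MIN (i, j)\<in>S. UXY {(i, j)} p q)})"
  by pat_completeness auto
termination
  by (relation "measures
      [case_sum card (case_sum (\<lambda>(S, p). card S) (\<lambda>(S, p, q). card S)),
       case_sum (\<lambda>_. 1) (\<lambda>_. 0)]")
    (auto intro!: card_Diff1_less intro: card_ge_0_finite)

declare L.simps [simp del] LX.simps [simp del] LXY.simps [simp del]
  U.simps [simp del] UX.simps [simp del] UXY.simps [simp del]

lemma bounds_singleton:
  "L {(i, j)} = PYc i j"
  "U {(i, j)} = PYc i j"
  "LX {(i, j)} p = max 0 (PYc i j - PXY j i - 1 + PX j + PX p)"
  "UX {(i, j)} p = min (PYc i j - PXY j i) (PX p)"
  "LXY {(i, j)} p q = max 0 (PYc i j + PXY p q - 1 + PX j - PXY j i)"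
  "UXY {(i, j)} p q = min (PYc i j - PXY j i) (PXY p q)"
  by (simp_all add: L.simps LX.simps LXY.simps U.simps UX.simps UXY.simps)

end

end

theory Submission
  imports Defs
begin

text \<open>
  Every entry of the recursion is a Frechet inequality or a law of total probability.  Intersecting
  with the event that \<open>X = x p\<close> and \<open>Y = y q\<close> costs at most the probability of its complement.
  Splitting over the value of \<open>X\<close>, consistency turns the piece \<open>X = x j\<close> of the event
  \<open>Yc (x j) = y i\<close> into \<open>X = x j \<and> Y = y i\<close>, which removes one counterfactual from the conjunction.
  Hence all bounds are valid by induction on the number of counterfactuals.
\<close>

context counterfactual_model
begin

section \<open>Events of the model and their measurability\<close>

definition event_Yc :: "(nat \<times> nat) set \<Rightarrow> 'w set"
  where "event_Yc S = {\<omega> \<in> space M. \<forall>(i, j)\<in>S. Yc (x j) \<omega> = y i}"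

definition event_X :: "nat \<Rightarrow> 'w set"
  where "event_X p = {\<omega> \<in> space M. X \<omega> = x p}"

definition event_XY :: "nat \<Rightarrow> nat \<Rightarrow> 'w set"
  where "event_XY p q = {\<omega> \<in> space M. X \<omega> = x p \<and> Y \<omega> = y q}"

text \<open>The index sets on which the recursion has its intended meaning:
  \<open>inj_on snd S\<close> says that \<open>j_1, ..., j_k\<close> are pairwise distinct, and
  nonemptiness keeps \<open>the_elem\<close> away from the empty set.\<close>

definition admissible :: "(nat \<times> nat) set \<Rightarrow> bool"
  where "admissible S \<longleftrightarrow>
    finite S \<and> S \<noteq> {} \<and> inj_on snd S \<and> fst ` S \<subseteq> {1..n} \<and> snd ` S \<subseteq> {1..m}"

lemma PX_eq: "PX p = prob (event_X p)"
  and PXY_eq: "PXY p q = prob (event_XY p q)"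
  and PYc_eq: "PYc i j = prob (event_Yc {(i, j)})"
  by (simp_all add: PX_def PXY_def PYc_def event_X_def event_XY_def event_Yc_def)

lemma event_X_sets [measurable]:
  assumes "p \<in> {1..m}"
  shows "event_X p \<in> events"
proof -
  have "X -` {x p} \<inter> space M \<in> events"
    using assms by (intro measurable_sets[OF measurable_X]) auto
  also have "X -` {x p} \<inter> space M = event_X p"
    by (auto simp: event_X_def)
  finally show ?thesis .
qed

lemma event_XY_sets [measurable]:
  assumes "p \<in> {1..m}" "q \<in> {1..n}"
  shows "event_XY p q \<in> events"
proof -
  have "Y -` {y q} \<inter> space M \<in> events"
    using assms by (intro measurable_sets[OF measurable_Y]) auto
  then have "event_X p \<inter> (Y -` {y q} \<inter> space M) \<in> events"
    using event_X_sets[OF assms(1)] by (rule sets.Int[rotated])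
  also have "event_X p \<inter> (Y -` {y q} \<inter> space M) = event_XY p q"
    by (auto simp: event_X_def event_XY_def)
  finally show ?thesis .
qed

lemma event_XY_subset: "event_XY p q \<subseteq> event_X p"
  by (auto simp: event_X_def event_XY_def)

lemma event_Yc_empty: "event_Yc {} = space M"
  and event_Yc_insert: "event_Yc (insert s S) = event_Yc {s} \<inter> event_Yc S"
  by (auto simp: event_Yc_def)

lemma event_Yc_subset_space: "event_Yc S \<subseteq> space M"
  by (auto simp: event_Yc_def)

lemma event_Yc_single_sets:
  assumes "i \<in> {1..n}" "j \<in> {1..m}"
  shows "event_Yc {(i, j)} \<in> events"
proof -
  have "Yc (x j) -` {y i} \<inter> space M \<in> events"
    using assms by (intro measurable_sets[OF measurable_Yc[of j]]) auto
  also have "Yc (x j) -` {y i} \<inter> space M = event_Yc {(i, j)}"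
    by (auto simp: event_Yc_def)
  finally show ?thesis .
qed

lemma event_Yc_sets:
  assumes "finite S" "fst ` S \<subseteq> {1..n}" "snd ` S \<subseteq> {1..m}"
  shows "event_Yc S \<in> events"
  using assms
proof (induction S rule: finite_induct)
  case empty
  then show ?case by (simp add: event_Yc_empty)
next
  case (insert s S)
  moreover obtain i j where "s = (i, j)" by (cases s)
  ultimately show ?case
    using event_Yc_single_sets[of i j] by (subst event_Yc_insert) auto
qed

section \<open>Frechet inequalities for conjunctions\<close>

lemma prob_Int_ge:
  assumes "A \<in> events" "B \<in> events"
  shows "prob A + prob B - 1 \<le> prob (A \<inter> B)"
proof -
  have "prob (A \<union> B) = prob A + prob B - prob (A \<inter> B)"
    using assms by (intro measure_Un3) (auto simp: fmeasurable_eq_sets)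
  then show ?thesis
    using prob_le_1[of "A \<union> B"] by linarith
qed

text \<open>Each counterfactual added to the conjunction costs at most 1, by the inequality for two
  events. \<open>B\<close> is the starting event of the induction, so the loss is
  \<open>card S\<close> in total.\<close>

lemma prob_event_Yc_ge:
  assumes "finite S" "fst ` S \<subseteq> {1..n}" "snd ` S \<subseteq> {1..m}" and B: "B \<in> events"
  shows "(\<Sum>(i, j)\<in>S. PYc i j) + prob B - card S \<le> prob (event_Yc S \<inter> B)"
  using assms(1-3)
proof (induction S rule: finite_induct)
  case empty
  then show ?case
    using sets.sets_into_space[OF B] by (simp add: event_Yc_empty Int_absorb1)
next
  case (insert s S)
  obtain i j where s: "s = (i, j)" by (cases s)
  have "event_Yc {s} \<in> events" "event_Yc S \<inter> B \<in> events"
    using insert s B by (auto intro!: event_Yc_single_sets event_Yc_sets sets.Int)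
  from prob_Int_ge[OF this] insert show ?case
    \<comment> \<open>The instance is fixed because the general equation would loop on
      \<open>{s}\<close>, itself an insertion.\<close>
    unfolding event_Yc_insert[of s S] unfolding s by (simp add: PYc_eq Int_assoc)
qed

section \<open>Consistency and a single counterfactual\<close>

lemma event_X_disjoint:
  assumes "p \<in> {1..m}" "p' \<in> {1..m}" "p \<noteq> p'"
  shows "event_X p \<inter> event_X p' = {}"
  using assms inj_on_eq_iff[OF inj_x, of p p'] by (auto simp: event_X_def)

text \<open>On \<open>X = x j\<close>, consistency trades the condition
  \<open>Yc (x j) = y i\<close> for the observation \<open>Y = y i\<close>. This is what shortens
  the conjunction in the recursion for \<open>L\<close> and \<open>U\<close>.\<close>

lemma event_Yc_Int_event_X:
  assumes "(i, j) \<in> S" "j \<in> {1..m}"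
  shows "event_Yc S \<inter> event_X j = event_Yc (S - {(i, j)}) \<inter> event_XY j i"
proof -
  have "Yc (x j) \<omega> = Y \<omega>" if "\<omega> \<in> space M" "X \<omega> = x j" for \<omega>
    using consistency assms(2) that by blast
  then show ?thesis
    using event_Yc_insert[of "(i, j)" "S - {(i, j)}"] assms(1)
    by (auto simp: insert_absorb event_Yc_def event_X_def event_XY_def)
qed

text \<open>By consistency the part of \<open>Yc (x j) = y i\<close> inside \<open>X = x j\<close>
  is \<open>event_XY j i\<close>, which \<open>B\<close> cannot meet. So only the rest, of
  probability \<open>PYc i j - PXY j i\<close>, matters, and it lies with \<open>B\<close> in the
  complement of \<open>X = x j\<close>. Keeping \<open>B\<close> general covers both
  \<open>X = x p\<close> and \<open>X = x p\<close> with \<open>Y = y q\<close>.\<close>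

lemma prob_event_Yc_single:
  assumes "i \<in> {1..n}" "j \<in> {1..m}" "p \<in> {1..m}" "p \<noteq> j"
    and B: "B \<in> events" "B \<subseteq> event_X p"
  shows "max 0 (PYc i j + prob B - 1 + PX j - PXY j i) \<le> prob (event_Yc {(i, j)} \<inter> B)"
    and "prob (event_Yc {(i, j)} \<inter> B) \<le> min (PYc i j - PXY j i) (prob B)"
proof -
  let ?A = "event_Yc {(i, j)}" and ?C = "event_XY j i" and ?D = "event_X j"
  note [measurable] = event_Yc_single_sets[OF assms(1,2)] event_XY_sets[OF assms(2,1)]
    event_X_sets[OF assms(2)] B(1)
  have AD: "?A \<inter> ?D = ?C"
    using event_Yc_Int_event_X[of i j "{(i, j)}"] assms
    by (auto simp: event_Yc_empty event_XY_def)
  have BD: "B \<inter> ?D = {}"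
    using event_X_disjoint[of p j] assms by auto
  have PA: "prob (?A - ?C) = PYc i j - PXY j i"
    using AD unfolding PYc_eq PXY_eq by (intro finite_measure_Diff) auto
  have AB: "?A \<inter> B = (?A - ?C) \<inter> B"
    using AD BD by auto
  have "prob ((?A - ?C) \<union> B) = prob (?A - ?C) + prob B - prob ((?A - ?C) \<inter> B)"
    by (intro measure_Un3) (auto simp: fmeasurable_eq_sets)
  \<comment> \<open>The union avoids \<open>?D\<close>, so its probability is at most
    \<open>1 - PX j\<close> instead of 1; this is where \<open>PX j\<close> enters the lower
    bound.\<close>
  moreover have "prob ((?A - ?C) \<union> B) \<le> prob (space M - ?D)"
    using AD BD sets.sets_into_space[OF B(1)]
    by (intro finite_measure_mono) (auto simp: event_Yc_def)
  moreover have "prob (space M - ?D) = 1 - PX j"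
    by (simp add: prob_compl PX_eq)
  ultimately show "max 0 (PYc i j + prob B - 1 + PX j - PXY j i) \<le> prob (?A \<inter> B)"
    using PA AB by simp
  have "prob (?A \<inter> B) \<le> prob (?A - ?C)" "prob (?A \<inter> B) \<le> prob B"
    unfolding AB by (auto intro!: finite_measure_mono)
  then show "prob (?A \<inter> B) \<le> min (PYc i j - PXY j i) (prob B)"
    using PA by simp
qed

section \<open>Bounds for a conjunction from those for its parts\<close>

lemma admissible_Diff:
  assumes "admissible S" "2 \<le> card S"
  shows "admissible (S - {s})"
proof -
  have "S - {s} \<noteq> {}"
  proof
    assume "S - {s} = {}"
    then have "card S \<le> card {s}" by (intro card_mono) auto
    then show False using assms by simp
  qed
  then show ?thesis
    using assms by (auto simp: admissible_def intro: inj_on_subset)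
qed

text \<open>The last entry is the inequality for two events, applied to the conjunction without
  \<open>(i, j)\<close> and to that counterfactual together with \<open>B\<close>. The parameter
  \<open>l\<close> stands for \<open>LX {(i, j)} p\<close> or \<open>LXY {(i, j)} p q\<close>, and
  for \<open>PYc i j\<close> when \<open>B\<close> is the whole space, so one proof serves all three
  lower bounds.\<close>

lemma prob_event_Yc_Int_ge:
  assumes S: "admissible S" and B: "B \<in> events"
    and L: "\<And>i j. (i, j) \<in> S \<Longrightarrow> L (S - {(i, j)}) \<le> prob (event_Yc (S - {(i, j)}))"
    and l: "\<And>i j. (i, j) \<in> S \<Longrightarrow> l i j \<le> prob (event_Yc {(i, j)} \<inter> B)"
  shows "Max {0, (\<Sum>(i, j)\<in>S. PYc i j) + prob B - real (card S),
      (MAX (i, j)\<in>S. L (S - {(i, j)}) + l i j - 1)} \<le> prob (event_Yc S \<inter> B)"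
proof -
  have "L (S - {(i, j)}) + l i j - 1 \<le> prob (event_Yc S \<inter> B)" if ij: "(i, j) \<in> S" for i j
  proof -
    have "event_Yc (S - {(i, j)}) \<in> events" "event_Yc {(i, j)} \<inter> B \<in> events"
      using S B ij by (auto simp: admissible_def intro!: event_Yc_sets sets.Int)
    from prob_Int_ge[OF this] L[OF ij] l[OF ij] show ?thesis
      using event_Yc_insert[of "(i, j)" "S - {(i, j)}"] ij by (simp add: insert_absorb Int_ac)
  qed
  then show ?thesis
    using S prob_event_Yc_ge[of S B] B by (auto simp: admissible_def)
qed

text \<open>Pure monotonicity: each entry bounds the probability of an event containing the
  conjunction. \<open>B\<close> and \<open>u\<close> are kept general for the same reuse as in the
  lower bound.\<close>

lemma prob_event_Yc_Int_le:
  assumes S: "admissible S" and B: "B \<in> events"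
    and U: "\<And>i j. (i, j) \<in> S \<Longrightarrow> prob (event_Yc (S - {(i, j)})) \<le> U (S - {(i, j)})"
    and u: "\<And>i j. (i, j) \<in> S \<Longrightarrow> prob (event_Yc {(i, j)} \<inter> B) \<le> u i j"
  shows "prob (event_Yc S \<inter> B) \<le> Min {(MIN (i, j)\<in>S. PYc i j), prob B,
      (MIN (i, j)\<in>S. U (S - {(i, j)})), (MIN (i, j)\<in>S. u i j)}"
proof -
  have ij: "prob (event_Yc S \<inter> B) \<le> PYc i j \<and> prob (event_Yc S \<inter> B) \<le> U (S - {(i, j)})
      \<and> prob (event_Yc S \<inter> B) \<le> u i j" if "(i, j) \<in> S" for i j
  proof -
    have "event_Yc {(i, j)} \<in> events" "event_Yc (S - {(i, j)}) \<in> events"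
      using S that by (auto simp: admissible_def intro!: event_Yc_sets)
    moreover have "event_Yc S = event_Yc {(i, j)} \<inter> event_Yc (S - {(i, j)})"
      using event_Yc_insert[of "(i, j)" "S - {(i, j)}"] that by (simp add: insert_absorb)
    ultimately have "prob (event_Yc S \<inter> B) \<le> prob (event_Yc {(i, j)})"
      "prob (event_Yc S \<inter> B) \<le> prob (event_Yc (S - {(i, j)}))"
      "prob (event_Yc S \<inter> B) \<le> prob (event_Yc {(i, j)} \<inter> B)"
      using B by (auto intro!: finite_measure_mono)
    then show ?thesis
      using U[OF that] u[OF that] by (auto simp: PYc_eq)
  qed
  have "prob (event_Yc S \<inter> B) \<le> prob B"
    using B by (intro finite_measure_mono) auto
  with ij S show ?thesis
    by (auto simp: admissible_def)
qed

section \<open>Total probability over the treatment\<close>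

lemma prob_event_Yc_split:
  assumes S: "admissible S"
  shows "prob (event_Yc S) = (\<Sum>(i, j)\<in>S. prob (event_Yc (S - {(i, j)}) \<inter> event_XY j i))
    + (\<Sum>p\<in>{1..m} - snd ` S. prob (event_Yc S \<inter> event_X p))"
proof -
  have ev: "event_Yc S \<in> events"
    using S by (auto simp: admissible_def intro!: event_Yc_sets)
  have J: "snd ` S \<subseteq> {1..m}" and inj: "inj_on snd S"
    using S by (auto simp: admissible_def)
  have "event_Yc S = (\<Union>p\<in>{1..m}. event_Yc S \<inter> event_X p)"
    using measurable_space[OF measurable_X] by (auto simp: event_Yc_def event_X_def)
  also have "prob \<dots> = (\<Sum>p\<in>{1..m}. prob (event_Yc S \<inter> event_X p))"
  proof (intro finite_measure_finite_Union)
    show "disjoint_family_on (\<lambda>p. event_Yc S \<inter> event_X p) {1..m}"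
      unfolding disjoint_family_on_def using event_X_disjoint by blast
  qed (use ev event_X_sets in auto)
  also have "\<dots> = (\<Sum>p\<in>snd ` S. prob (event_Yc S \<inter> event_X p))
      + (\<Sum>p\<in>{1..m} - snd ` S. prob (event_Yc S \<inter> event_X p))"
    using J by (subst sum.subset_diff[of "snd ` S"]) (auto simp: add.commute)
  also have "(\<Sum>p\<in>snd ` S. prob (event_Yc S \<inter> event_X p))
      = (\<Sum>(i, j)\<in>S. prob (event_Yc (S - {(i, j)}) \<inter> event_XY j i))"
    unfolding sum.reindex[OF inj] using J
    by (intro sum.cong) (auto simp: event_Yc_Int_event_X)
  finally show ?thesis .
qed

text \<open>The hypotheses follow the calls made by \<open>L S\<close> and \<open>U S\<close>:
  smaller sets for \<open>L\<close>, \<open>U\<close>, \<open>LXY\<close> and \<open>UXY\<close>,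
  but the same \<open>S\<close> for \<open>LX\<close> and \<open>UX\<close>.\<close>

lemma prob_event_Yc_bounds_step:
  assumes S: "admissible S" and card: "2 \<le> card S"
    and IH: "\<And>i j. (i, j) \<in> S \<Longrightarrow>
      L (S - {(i, j)}) \<le> prob (event_Yc (S - {(i, j)})) \<and>
      prob (event_Yc (S - {(i, j)})) \<le> U (S - {(i, j)})"
    and IHXY: "\<And>i j. (i, j) \<in> S \<Longrightarrow>
      LXY (S - {(i, j)}) j i \<le> prob (event_Yc (S - {(i, j)}) \<inter> event_XY j i) \<and>
      prob (event_Yc (S - {(i, j)}) \<inter> event_XY j i) \<le> UXY (S - {(i, j)}) j i"
    and X: "\<And>p. p \<in> {1..m} - snd ` S \<Longrightarrow>
      LX S p \<le> prob (event_Yc S \<inter> event_X p) \<and> prob (event_Yc S \<inter> event_X p) \<le> UX S p"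
  shows "L S \<le> prob (event_Yc S) \<and> prob (event_Yc S) \<le> U S"
proof
  have fin: "finite S" "S \<noteq> {}" using S by (auto simp: admissible_def)
  have space: "event_Yc S \<inter> space M = event_Yc S" for S
    using event_Yc_subset_space by auto
  have "(\<Sum>(i, j)\<in>S. LXY (S - {(i, j)}) j i) + (\<Sum>p\<in>{1..m} - snd ` S. LX S p)
      \<le> prob (event_Yc S)"
    unfolding prob_event_Yc_split[OF S]
    using IHXY X by (intro add_mono sum_mono) auto
  \<comment> \<open>With the whole space as \<open>B\<close>, the term
    \<open>prob (space M) = 1\<close> supplies the \<open>+ 1\<close> in the second entry of
    \<open>L S\<close>.\<close>
  moreover have "Max {0, (\<Sum>(i, j)\<in>S. PYc i j) + prob (space M) - real (card S),
      (MAX (i, j)\<in>S. L (S - {(i, j)}) + PYc i j - 1)} \<le> prob (event_Yc S \<inter> space M)"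
    using IH by (intro prob_event_Yc_Int_ge S) (auto simp: PYc_eq space)
  ultimately show "L S \<le> prob (event_Yc S)"
    using card fin by (subst L.simps) (simp add: space prob_space)
  have "prob (event_Yc S)
      \<le> (\<Sum>(i, j)\<in>S. UXY (S - {(i, j)}) j i) + (\<Sum>p\<in>{1..m} - snd ` S. UX S p)"
    unfolding prob_event_Yc_split[OF S]
    using IHXY X by (intro add_mono sum_mono) auto
  moreover have "prob (event_Yc S \<inter> space M) \<le> Min {(MIN (i, j)\<in>S. PYc i j), prob (space M),
      (MIN (i, j)\<in>S. U (S - {(i, j)})), (MIN (i, j)\<in>S. PYc i j)}"
    using IH by (intro prob_event_Yc_Int_le S) (auto simp: PYc_eq space)
  ultimately show "prob (event_Yc S) \<le> U S"
    using card fin by (subst U.simps) (simp add: space)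
qed

section \<open>Validity of all bounds by induction\<close>

text \<open>Finiteness and nonemptiness exclude \<open>card S = 0\<close>, so the base branch of the
  recursion is met only at true singletons.\<close>

lemma admissible_card_le_1:
  assumes "admissible S" "card S \<le> 1"
  obtains i j where "S = {(i, j)}" "i \<in> {1..n}" "j \<in> {1..m}"
proof -
  have "card S = 1"
    using assms by (metis One_nat_def Suc_leI admissible_def card_gt_0_iff le_antisym)
  then obtain s where "S = {s}" by (auto simp: card_1_singleton_iff)
  with assms that show thesis by (cases s) (auto simp: admissible_def)
qed

lemma singleton_bounds:
  assumes "i \<in> {1..n}" "j \<in> {1..m}" "p \<in> {1..m}" "p \<noteq> j"
  shows "LX {(i, j)} p \<le> prob (event_Yc {(i, j)} \<inter> event_X p)"
    and "prob (event_Yc {(i, j)} \<inter> event_X p) \<le> UX {(i, j)} p"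
    and "q \<in> {1..n} \<Longrightarrow> LXY {(i, j)} p q \<le> prob (event_Yc {(i, j)} \<inter> event_XY p q)"
    and "q \<in> {1..n} \<Longrightarrow> prob (event_Yc {(i, j)} \<inter> event_XY p q) \<le> UXY {(i, j)} p q"
  using prob_event_Yc_single[OF assms event_X_sets[OF assms(3)] subset_refl]
    prob_event_Yc_single[OF assms event_XY_sets[OF assms(3)] event_XY_subset, of q]
  by (simp_all add: bounds_singleton PX_eq PXY_eq algebra_simps)

text \<open>All six bounds are proved together because the functions are mutually recursive. The
  bounds with suffix \<open>X\<close> or \<open>XY\<close> use only smaller sets and singletons, so
  for each \<open>S\<close> they come before those for \<open>L S\<close> and
  \<open>U S\<close>.\<close>

lemma bounds_valid:
  assumes "admissible S"
  shows "L S \<le> prob (event_Yc S) \<and> prob (event_Yc S) \<le> U S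
    \<and> (\<forall>p\<in>{1..m} - snd ` S.
         LX S p \<le> prob (event_Yc S \<inter> event_X p) \<and> prob (event_Yc S \<inter> event_X p) \<le> UX S p
       \<and> (\<forall>q\<in>{1..n}. LXY S p q \<le> prob (event_Yc S \<inter> event_XY p q)
            \<and> prob (event_Yc S \<inter> event_XY p q) \<le> UXY S p q))"
  using assms
proof (induction "card S" arbitrary: S rule: less_induct)
  case less
  note S = less.prems
  show ?case
  proof (cases "card S \<le> 1")
    case True
    then obtain i j where ij: "S = {(i, j)}" "i \<in> {1..n}" "j \<in> {1..m}"
      using S admissible_card_le_1 by blast
    then show ?thesis
      using singleton_bounds by (auto simp: bounds_singleton(1,2) PYc_eq)
  next
    case False
    then have card: "2 \<le> card S" and nle: "\<not> card S \<le> 1" by auto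
    have fin: "finite S" using S by (auto simp: admissible_def)
    have mem: "i \<in> {1..n}" "j \<in> {1..m}" if "(i, j) \<in> S" for i j
      using S that by (force simp: admissible_def)+
    \<comment> \<open>After \<open>(i, j)\<close> is removed, \<open>j\<close> is a treatment index
      outside the remaining ones, so the induction hypothesis may be used with \<open>p = j\<close>
      and \<open>q = i\<close>.\<close>
    have snd_Diff: "j \<notin> snd ` (S - {(i, j)})" if "(i, j) \<in> S" for i j
    proof -
      have "inj_on snd S" using S by (simp add: admissible_def)
      from inj_on_image_set_diff[OF this, of S "{(i, j)}"] that show ?thesis by auto
    qed
    have IH: "L (S - {(i, j)}) \<le> prob (event_Yc (S - {(i, j)}))"
      "prob (event_Yc (S - {(i, j)})) \<le> U (S - {(i, j)})"
      "LXY (S - {(i, j)}) j i \<le> prob (event_Yc (S - {(i, j)}) \<inter> event_XY j i)"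
      "prob (event_Yc (S - {(i, j)}) \<inter> event_XY j i) \<le> UXY (S - {(i, j)}) j i"
      if "(i, j) \<in> S" for i j
      using less.hyps[OF card_Diff1_less[OF fin that] admissible_Diff[OF S card]]
        snd_Diff[OF that] mem[OF that] by auto
    have ne: "p \<noteq> j" if "p \<in> {1..m} - snd ` S" "(i, j) \<in> S" for i j p
      using that image_eqI[of j snd "(i, j)" S] by auto
    have LX: "LX S p \<le> prob (event_Yc S \<inter> event_X p)" if p: "p \<in> {1..m} - snd ` S" for p
      using nle prob_event_Yc_Int_ge[OF S event_X_sets[of p] IH(1),
          of "\<lambda>i j. LX {(i, j)} p"] singleton_bounds(1) mem ne[OF p] p
      by (subst LX.simps) (simp add: PX_eq)
    have UX: "prob (event_Yc S \<inter> event_X p) \<le> UX S p" if p: "p \<in> {1..m} - snd ` S" for p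
      using nle prob_event_Yc_Int_le[OF S event_X_sets[of p] IH(2),
          of "\<lambda>i j. UX {(i, j)} p"] singleton_bounds(2) mem ne[OF p] p
      by (subst UX.simps) (simp add: PX_eq)
    have LXY: "LXY S p q \<le> prob (event_Yc S \<inter> event_XY p q)"
      if p: "p \<in> {1..m} - snd ` S" and q: "q \<in> {1..n}" for p q
      using nle prob_event_Yc_Int_ge[OF S event_XY_sets[of p q] IH(1),
          of "\<lambda>i j. LXY {(i, j)} p q"] singleton_bounds(3) mem ne[OF p] p q
      by (subst LXY.simps) (simp add: PXY_eq)
    have UXY: "prob (event_Yc S \<inter> event_XY p q) \<le> UXY S p q"
      if p: "p \<in> {1..m} - snd ` S" and q: "q \<in> {1..n}" for p q
      using nle prob_event_Yc_Int_le[OF S event_XY_sets[of p q] IH(2),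
          of "\<lambda>i j. UXY {(i, j)} p q"] singleton_bounds(4) mem ne[OF p] p q
      by (subst UXY.simps) (simp add: PXY_eq)
    have "L S \<le> prob (event_Yc S) \<and> prob (event_Yc S) \<le> U S"
      using IH LX UX by (intro prob_event_Yc_bounds_step[OF S card]) auto
    then show ?thesis using LX UX LXY UXY by blast
  qed
qed

end

theorem theorem11:
  fixes M :: "'w measure"
    and X :: "'w \<Rightarrow> 'x" and Y :: "'w \<Rightarrow> 'y" and Yc :: "'x \<Rightarrow> 'w \<Rightarrow> 'y"
    and x :: "nat \<Rightarrow> 'x" and y :: "nat \<Rightarrow> 'y"
    and m n k p q :: nat and i j :: "nat \<Rightarrow> nat" and S :: "(nat \<times> nat) set"
  assumes "counterfactual_model M X Y Yc x m y n"
    and "k \<ge> 2"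
    and "\<And>t. t \<in> {1..k} \<Longrightarrow> i t \<in> {1..n}" and "q \<in> {1..n}"
    and "\<And>t. t \<in> {1..k} \<Longrightarrow> j t \<in> {1..m}" and "p \<in> {1..m}"
    and "inj_on j {1..k}" and "p \<notin> j ` {1..k}"
    and "S = (\<lambda>t. (i t, j t)) ` {1..k}"
  shows "\<P>(\<omega> in M. (\<forall>t\<in>{1..k}. Yc (x (j t)) \<omega> = y (i t)) \<and> X \<omega> = x p \<and> Y \<omega> = y q)
      \<ge> Max {0,
          (\<Sum>t = 1..k. \<P>(\<omega> in M. Yc (x (j t)) \<omega> = y (i t)))
            + \<P>(\<omega> in M. X \<omega> = x p \<and> Y \<omega> = y q) - real k,
          (MAX t\<in>{1..k}. counterfactual_model.L M X Y Yc x m y (S - {(i t, j t)})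
            + counterfactual_model.LXY M X Y Yc x m y {(i t, j t)} p q - 1)}
    \<and> \<P>(\<omega> in M. (\<forall>t\<in>{1..k}. Yc (x (j t)) \<omega> = y (i t)) \<and> X \<omega> = x p \<and> Y \<omega> = y q)
      \<le> Min {
          (MIN t\<in>{1..k}. \<P>(\<omega> in M. Yc (x (j t)) \<omega> = y (i t))),
          \<P>(\<omega> in M. X \<omega> = x p \<and> Y \<omega> = y q),
          (MIN t\<in>{1..k}. counterfactual_model.U M X Y Yc x m y (S - {(i t, j t)})),
          (MIN t\<in>{1..k}. counterfactual_model.UXY M X Y Yc x m y {(i t, j t)} p q)}"
proof -
  interpret counterfactual_model M X Y Yc x m y n by (rule assms(1))
  \<comment> \<open>Distinct \<open>j t\<close> make \<open>t\<close> recoverable from the pair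
    \<open>(i t, j t)\<close> even if values \<open>i t\<close> repeat. Hence
    \<open>card S = k\<close>, and sums over \<open>t\<close> are sums over
    \<open>S\<close>.\<close>
  have inj_snd: "inj_on (snd \<circ> (\<lambda>t. (i t, j t))) {1..k}"
    using assms(7) by (simp add: comp_def)
  then have inj: "inj_on (\<lambda>t. (i t, j t)) {1..k}"
    by (rule inj_on_imageI2)
  have card: "card S = k"
    using assms(9) card_image[OF inj] by simp
  have S: "admissible S"
    using assms(2,3,5) inj_on_imageI[OF inj_snd] unfolding admissible_def assms(9) by auto
  have sub: "L (S - {(a, b)}) \<le> prob (event_Yc (S - {(a, b)}))"
    "prob (event_Yc (S - {(a, b)})) \<le> U (S - {(a, b)})" for a b
    using bounds_valid[OF admissible_Diff[OF S]] card assms(2) by auto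
  have single: "LXY {(a, b)} p q \<le> prob (event_Yc {(a, b)} \<inter> event_XY p q)"
    "prob (event_Yc {(a, b)} \<inter> event_XY p q) \<le> UXY {(a, b)} p q" if "(a, b) \<in> S" for a b
    using that assms(3-6,8,9) by (auto intro!: singleton_bounds)
  have ev: "{\<omega> \<in> space M. (\<forall>t\<in>{1..k}. Yc (x (j t)) \<omega> = y (i t)) \<and> X \<omega> = x p \<and> Y \<omega> = y q}
      = event_Yc S \<inter> event_XY p q"
    by (auto simp: assms(9) event_Yc_def event_XY_def)
  have sum: "(\<Sum>(a, b)\<in>S. PYc a b) = (\<Sum>t = 1..k. PYc (i t) (j t))"
    unfolding assms(9) sum.reindex[OF inj] by simp
  \<comment> \<open>A general \<open>f\<close> lets one equation translate every maximum and minimum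
    over \<open>S\<close> into one over \<open>t\<close>.\<close>
  have img: "(\<lambda>(a, b). f a b) ` S = (\<lambda>t. f (i t) (j t)) ` {1..k}" for f :: "nat \<Rightarrow> nat \<Rightarrow> real"
    unfolding assms(9) by (simp add: image_image)
  note XY = event_XY_sets[OF assms(6,4)]
  show ?thesis
    \<comment> \<open>The claim is the pair of conjunction bounds with \<open>event_XY p q\<close>
      as \<open>B\<close>; validity of the recursive bounds enters only for the sets
      \<open>S - {(a, b)}\<close> and the singletons.\<close>
    using prob_event_Yc_Int_ge[OF S XY sub(1) single(1)]
      prob_event_Yc_Int_le[OF S XY sub(2) single(2)]
    unfolding ev sum img card PXY_eq[symmetric] by (simp only: PXY_def PYc_def)
qed

end
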